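(* Let $\Omega$ and $\Omega'$ be two matrices indexed by the same finite set $I$ and satisfying conditions (a), (b), (c) of the context. If the Cartan data associated to $\Omega$ and $\Omega'$ are the same, i.e. $\Omega_{ij}+\Omega_{ji}=\Omega'_{ij}+\Omega'_{ji}$ for all $i,j\in I$, then the assignment $\theta_i\mapsto\theta_i$, $i\in I$, gives a twisted bialgebra isomorphism $(\mathfrak{f},*,\widetilde r)\simeq(\mathfrak{f}(\Omega'),*,\widetilde r)$, where $\mathfrak{f}=\mathfrak{f}(\Omega)$; that is, an isomorphism of $\mathbb{Q}(v,t)$-algebras with respect to the products $*$ that intertwines the comultiplications $\widetilde r$.
   Context: **Datum.** $I$ is a finite set and $\Omega=(\Omega_{ij})_{i,j\in I}$ an integer matrix such that (a) $\Omega_{ii}\in\mathbb{Z}_{>0}$ and $\Omega_{ij}\in\mathbb{Z}_{\le0}$ for $i\neq j$; (b) $\frac{\Omega_{ij}+\Omega_{ji}}{\Omega_{ii}}\in\mathbb{Z}_{\le0}$ for $i\ne j$; (c) $\gcd_i(\Omega_{ii})=1$. Bilinear forms on $\mathbb{Z}^I$: $\langle i,j\rangle=\Omega_{ij}$, $[i,j]=2\delta_{ij}\Omega_{ii}-\Omega_{ij}$, $i\cdot j=\langle i,j\rangle+\langle j,i\rangle$. $(I,\cdot)$ is the associated Cartan datum. For indeterminates $v,t$ put $v_i=v^{i\cdot i/2}$. **The algebra $\mathfrak{f}=\mathfrak{f}(\Omega)$.** ${}'\mathfrak{f}$ is the free unital associative $\mathbb{Q}(v,t)$-algebra on $\theta_i$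 ($i\in I$), $\mathbb{N}^I$-graded with $|\theta_i|=i$. ${}'\mathfrak{f}\otimes{}'\mathfrak{f}$ has multiplication $(x_1\otimes x_2)(y_1\otimes y_2)=v^{-|y_1|\cdot|x_2|}t^{\langle|y_1|,|x_2|\rangle-\langle|x_2|,|y_1|\rangle}x_1y_1\otimes x_2y_2$ on homogeneous elements, and $r:{}'\mathfrak{f}\to{}'\mathfrak{f}\otimes{}'\mathfrak{f}$ is the algebra homomorphism with $r(\theta_i)=\theta_i\otimes1+1\otimes\theta_i$. There is a unique (symmetric) $\mathbb{Q}(v,t)$-valued bilinear form $(,)$ on ${}'\mathfrak{f}$ with $(1,1)=1$, $(\theta_i,\theta_j)=\delta_{ij}(1-v_i^{-2})^{-1}$, $(x,y'y'')=(r(x),y'\otimes y'')$, $(x'x'',y)=(x'\otimes x'',r(y))$, where $(x_1\otimes x_2,y_1\otimes y_2)=t^{2[|x_1|,|x_2|]}(x_1,y_1)(x_2,y_2)$. Its radical is a two-sided ideal, $\mathfrak{f}$ is the quotient of ${}'\mathfrak{f}$ by it, and $r$ descends to $\mathfrak{f}$. **Second bialgebra structure.** On $\mathfrak{f}$: $x*y=t^{-[|x|,|y|]}xy$ for homogeneous $x,y$. On $\mathfrak{f}\otimes\mathfrak{f}$: $(x_1\otimes x_2)*(y_1\otimes y_2)=v^{-|y_1|\cdot|x_2|}(x_1*y_1)\otimes(x_2*y_2)$. $\widetilde r(x)=\sum t^{[|x_1|,|x_2|]}x_1\otimes x_2$ if $r(x)=\sum x_1\otimes x_2$ with $x_1,x_2$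 homogeneous; $\widetilde r$ is an algebra homomorphism for $*$. For $\Omega'$ all these objects are defined using the forms attached to $\Omega'$. *)

theory Defs
  imports
    "HOL-Library.Poly_Mapping"
    "HOL-Computational_Algebra.Polynomial_Factorial"
    "HOL-Algebra.Algebra"
    "HOL-Algebra.Algebraic_Closure_Type"
begin

text \<open>The finite index set is the type \<open>'i::finite\<close>. It is automatically nonempty, as it must be,
  since the gcd of the empty family is \<open>0\<close>.\<close>

definition admissible :: "('i::finite \<Rightarrow> 'i \<Rightarrow> int) \<Rightarrow> bool" where
  "admissible \<Omega> \<longleftrightarrow>
     (\<forall>i. \<Omega> i i > 0) \<and>
     (\<forall>i j. i \<noteq> j \<longrightarrow> \<Omega> i j \<le> 0) \<and>
     (\<forall>i j. i \<noteq> j \<longrightarrow> \<Omega> i i dvd \<Omega> i j + \<Omega> j i \<and> (\<Omega> i j + \<Omega> j i) div \<Omega> i i \<le> 0) \<and>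
     Gcd (range (\<lambda>i. \<Omega> i i)) = 1"

text \<open>\<open>ang\<close>, \<open>sqf\<close> and \<open>dotf\<close> are the bilinear forms written \<open>\<langle>a,b\<rangle>\<close>, \<open>[a,b]\<close> and \<open>a \<cdot> b\<close>.\<close>

definition ang :: "('i::finite \<Rightarrow> 'i \<Rightarrow> int) \<Rightarrow> ('i \<Rightarrow> int) \<Rightarrow> ('i \<Rightarrow> int) \<Rightarrow> int" where
  "ang \<Omega> a b = (\<Sum>i\<in>UNIV. \<Sum>j\<in>UNIV. a i * b j * \<Omega> i j)"

definition sqf :: "('i::finite \<Rightarrow> 'i \<Rightarrow> int) \<Rightarrow> ('i \<Rightarrow> int) \<Rightarrow> ('i \<Rightarrow> int) \<Rightarrow> int" where
  "sqf \<Omega> a b = (\<Sum>i\<in>UNIV. \<Sum>j\<in>UNIV. a i * b j * ((if i = j then 2 * \<Omega> i i else 0) - \<Omega> i j))"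

definition dotf :: "('i::finite \<Rightarrow> 'i \<Rightarrow> int) \<Rightarrow> ('i \<Rightarrow> int) \<Rightarrow> ('i \<Rightarrow> int) \<Rightarrow> int" where
  "dotf \<Omega> a b = ang \<Omega> a b + ang \<Omega> b a"

text \<open>\<open>\<rat>(v,t)\<close> is realised as \<open>\<rat>(v)(t)\<close>.\<close>

type_synonym qvt = "rat poly fract poly fract"

definition vv :: qvt where "vv = to_fract [:to_fract [:0, 1:]:]"

definition tt :: qvt where "tt = to_fract [:0, 1:]"

definition scale :: "'k::field \<Rightarrow> ('a \<Rightarrow>\<^sub>0 'k) \<Rightarrow> ('a \<Rightarrow>\<^sub>0 'k)" where
  "scale c p = Poly_Mapping.map ((*) c) p"

lemma lookup_scale [simp]: "Poly_Mapping.lookup (scale c p) k = c * Poly_Mapping.lookup p k"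
  by (simp add: scale_def Poly_Mapping.map.rep_eq when_def)

interpretation free: vector_space scale
  by unfold_locales (auto intro!: poly_mapping_eqI simp: lookup_add algebra_simps)

definition lin_ext :: "('a \<Rightarrow> ('b \<Rightarrow>\<^sub>0 'k::field)) \<Rightarrow> ('a \<Rightarrow>\<^sub>0 'k) \<Rightarrow> ('b \<Rightarrow>\<^sub>0 'k)" where
  "lin_ext g p = (\<Sum>k\<in>Poly_Mapping.keys p. scale (Poly_Mapping.lookup p k) (g k))"

text \<open>The tensor square of a vector space \<open>M\<close> consists of the classes of formal linear
  combinations of pairs modulo the bilinearity relations.\<close>

definition tensor_rel :: "('k::field, 'a, 'm) module_scheme \<Rightarrow> ('a \<times> 'a \<Rightarrow>\<^sub>0 'k) set" where
  "tensor_rel M = free.span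
     (let p = (\<lambda>x y. Poly_Mapping.single (x, y) 1) in
      {p (x \<oplus>\<^bsub>M\<^esub> y) z - p x z - p y z | x y z. x \<in> carrier M \<and> y \<in> carrier M \<and> z \<in> carrier M} \<union>
      {p z (x \<oplus>\<^bsub>M\<^esub> y) - p z x - p z y | x y z. x \<in> carrier M \<and> y \<in> carrier M \<and> z \<in> carrier M} \<union>
      {p (c \<odot>\<^bsub>M\<^esub> x) z - scale c (p x z) | c x z. x \<in> carrier M \<and> z \<in> carrier M} \<union>
      {p z (c \<odot>\<^bsub>M\<^esub> x) - scale c (p z x) | c x z. x \<in> carrier M \<and> z \<in> carrier M})"

definition tensor_class ::
  "('k::field, 'a, 'm) module_scheme \<Rightarrow> ('a \<times> 'a \<Rightarrow>\<^sub>0 'k) \<Rightarrow> ('a \<times> 'a \<Rightarrow>\<^sub>0 'k) set" where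
  "tensor_class M z = {z'. z' - z \<in> tensor_rel M}"

text \<open>The map \<open>\<phi> \<otimes> \<phi>\<close> into the tensor square of \<open>N\<close>; the union is over all representatives, which
  give the same class when \<open>\<phi>\<close> is linear.\<close>

definition tensor_map ::
  "('k::field, 'b, 'm) module_scheme \<Rightarrow> ('a \<Rightarrow> 'b) \<Rightarrow> ('a \<times> 'a \<Rightarrow>\<^sub>0 'k) set \<Rightarrow> ('b \<times> 'b \<Rightarrow>\<^sub>0 'k) set" where
  "tensor_map N \<phi> Z =
     (\<Union>z\<in>Z. tensor_class N (lin_ext (\<lambda>(x, y). Poly_Mapping.single (\<phi> x, \<phi> y) 1) z))"

record (overloaded) ('k::zero, 'a) bialg = "('k, 'a) module" +
  comult :: "'a \<Rightarrow> ('a \<times> 'a \<Rightarrow>\<^sub>0 'k) set"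

definition bialg_iso ::
  "('k::field, 'a, 'm) bialg_scheme \<Rightarrow> ('k, 'b, 'n) bialg_scheme \<Rightarrow> ('a \<Rightarrow> 'b) set" where
  "bialg_iso A B = {\<phi> \<in> ring_iso A B.
     (\<forall>c. \<forall>x\<in>carrier A. \<phi> (c \<odot>\<^bsub>A\<^esub> x) = c \<odot>\<^bsub>B\<^esub> \<phi> x) \<and>
     (\<forall>x\<in>carrier A. comult B (\<phi> x) = tensor_map B \<phi> (comult A x))}"

text \<open>With concatenation as addition on words, the ring structure of \<open>Poly_Mapping\<close> makes finitely
  supported functions on words the free associative algebra.\<close>

instantiation list :: (type) monoid_add
begin
definition zero_list :: "'a list" where "zero_list = []"
definition plus_list :: "'a list \<Rightarrow> 'a list \<Rightarrow> 'a list" where "plus_list = (@)"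
instance by standard (simp_all add: zero_list_def plus_list_def)
end

type_synonym 'i fa = "'i list \<Rightarrow>\<^sub>0 qvt"

text \<open>\<open>'f \<otimes> 'f\<close> is written in the basis of pairs of words. Its product is \<open>tmul\<close> below, never the
  convolution product.\<close>

type_synonym 'i fa2 = "'i list \<times> 'i list \<Rightarrow>\<^sub>0 qvt"

definition theta :: "'i \<Rightarrow> 'i fa" where
  "theta i = Poly_Mapping.single [i] 1"

definition wt :: "'i list \<Rightarrow> 'i \<Rightarrow> int" where
  "wt w i = int (count_list w i)"

definition homogeneous :: "('i \<Rightarrow> int) \<Rightarrow> 'i fa \<Rightarrow> bool" where
  "homogeneous \<nu> x \<longleftrightarrow> (\<forall>w\<in>Poly_Mapping.keys x. wt w = \<nu>)"

definition tensor :: "'i fa \<Rightarrow> 'i fa \<Rightarrow> 'i fa2" where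
  "tensor x y = lin_ext (\<lambda>u. lin_ext (\<lambda>w. Poly_Mapping.single (u, w) 1) y) x"

definition tmul :: "('i::finite \<Rightarrow> 'i \<Rightarrow> int) \<Rightarrow> 'i fa2 \<Rightarrow> 'i fa2 \<Rightarrow> 'i fa2" where
  "tmul \<Omega> p q = lin_ext (\<lambda>(x1, x2). lin_ext (\<lambda>(y1, y2).
     Poly_Mapping.single (x1 @ y1, x2 @ y2)
       (vv powi (- dotf \<Omega> (wt y1) (wt x2)) *
        tt powi (ang \<Omega> (wt y1) (wt x2) - ang \<Omega> (wt x2) (wt y1)))) q) p"

primrec r_word :: "('i::finite \<Rightarrow> 'i \<Rightarrow> int) \<Rightarrow> 'i list \<Rightarrow> 'i fa2" where
  "r_word \<Omega> [] = tensor 1 1"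
| "r_word \<Omega> (i # w) = tmul \<Omega> (tensor (theta i) 1 + tensor 1 (theta i)) (r_word \<Omega> w)"

definition r :: "('i::finite \<Rightarrow> 'i \<Rightarrow> int) \<Rightarrow> 'i fa \<Rightarrow> 'i fa2" where
  "r \<Omega> = lin_ext (r_word \<Omega>)"

definition bilinear_form :: "('i fa \<Rightarrow> 'i fa \<Rightarrow> qvt) \<Rightarrow> bool" where
  "bilinear_form B \<longleftrightarrow>
     (\<forall>x. Vector_Spaces.linear scale (*) (\<lambda>y. B x y)) \<and>
     (\<forall>y. Vector_Spaces.linear scale (*) (\<lambda>x. B x y))"

definition tensor_form ::
  "('i::finite \<Rightarrow> 'i \<Rightarrow> int) \<Rightarrow> ('i fa \<Rightarrow> 'i fa \<Rightarrow> qvt) \<Rightarrow> 'i fa2 \<Rightarrow> 'i fa2 \<Rightarrow> qvt" where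
  "tensor_form \<Omega> B p q = (\<Sum>(x1, x2)\<in>Poly_Mapping.keys p. \<Sum>(y1, y2)\<in>Poly_Mapping.keys q.
     Poly_Mapping.lookup p (x1, x2) * Poly_Mapping.lookup q (y1, y2) *
     (tt powi (2 * sqf \<Omega> (wt x1) (wt x2)) *
      B (Poly_Mapping.single x1 1) (Poly_Mapping.single y1 1) *
      B (Poly_Mapping.single x2 1) (Poly_Mapping.single y2 1)))"

text \<open>Since \<open>wt [i]\<close> is the basis vector \<open>i\<close>, the exponent \<open>dotf \<Omega> (wt [i]) (wt [i]) div 2\<close>
  (an exact division) gives \<open>v\<^sub>i\<close>.\<close>

definition is_form :: "('i::finite \<Rightarrow> 'i \<Rightarrow> int) \<Rightarrow> ('i fa \<Rightarrow> 'i fa \<Rightarrow> qvt) \<Rightarrow> bool" where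
  "is_form \<Omega> B \<longleftrightarrow> bilinear_form B \<and>
     (\<forall>x y. B x y = B y x) \<and>
     B 1 1 = 1 \<and>
     (\<forall>i j. B (theta i) (theta j) =
        (if i = j
         then inverse (1 - (vv powi (dotf \<Omega> (wt [i]) (wt [i]) div 2)) powi (-2)) else 0)) \<and>
     (\<forall>x y' y''. B x (y' * y'') = tensor_form \<Omega> B (r \<Omega> x) (tensor y' y'')) \<and>
     (\<forall>x' x'' y. B (x' * x'') y = tensor_form \<Omega> B (tensor x' x'') (r \<Omega> y))"

definition form :: "('i::finite \<Rightarrow> 'i \<Rightarrow> int) \<Rightarrow> 'i fa \<Rightarrow> 'i fa \<Rightarrow> qvt" where
  "form \<Omega> = (THE B. is_form \<Omega> B)"

definition rad :: "('i::finite \<Rightarrow> 'i \<Rightarrow> int) \<Rightarrow> 'i fa set" where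
  "rad \<Omega> = {x. \<forall>y. form \<Omega> x y = 0}"

definition proj :: "('i::finite \<Rightarrow> 'i \<Rightarrow> int) \<Rightarrow> 'i fa \<Rightarrow> 'i fa set" where
  "proj \<Omega> x = rad \<Omega> +>\<^bsub>ring_of_type_algebra\<^esub> x"

text \<open>The algebra \<open>f(\<Omega>)\<close> with its ordinary product. Operations on cosets that are not provided
  by \<open>Quot\<close> are given on representatives.\<close>

definition f_alg :: "('i::finite \<Rightarrow> 'i \<Rightarrow> int) \<Rightarrow> (qvt, 'i fa set) module" where
  "f_alg \<Omega> = (let Q = ring_of_type_algebra Quot rad \<Omega> in
     \<lparr>carrier = carrier Q, monoid.mult = (\<otimes>\<^bsub>Q\<^esub>), one = \<one>\<^bsub>Q\<^esub>, ring.zero = \<zero>\<^bsub>Q\<^esub>, add = (\<oplus>\<^bsub>Q\<^esub>),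
      module.smult = (\<lambda>c U. \<Union>x\<in>U. proj \<Omega> (scale c x))\<rparr>)"

definition star_free :: "('i::finite \<Rightarrow> 'i \<Rightarrow> int) \<Rightarrow> 'i fa \<Rightarrow> 'i fa \<Rightarrow> 'i fa" where
  "star_free \<Omega> x y = lin_ext (\<lambda>u. lin_ext (\<lambda>w.
     Poly_Mapping.single (u @ w) (tt powi (- sqf \<Omega> (wt u) (wt w)))) y) x"

definition star :: "('i::finite \<Rightarrow> 'i \<Rightarrow> int) \<Rightarrow> 'i fa set \<Rightarrow> 'i fa set \<Rightarrow> 'i fa set" where
  "star \<Omega> U V = (\<Union>x\<in>U. \<Union>y\<in>V. proj \<Omega> (star_free \<Omega> x y))"

text \<open>The coproduct on the quotient: apply \<open>r\<close> to a representative, rescale the component of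
  bidegree \<open>(\<mu>, \<nu>)\<close> by \<open>t\<close> to the power \<open>[\<mu>, \<nu>]\<close>, and project both tensor factors.\<close>

definition rtilde ::
  "('i::finite \<Rightarrow> 'i \<Rightarrow> int) \<Rightarrow> 'i fa set \<Rightarrow> ('i fa set \<times> 'i fa set \<Rightarrow>\<^sub>0 qvt) set" where
  "rtilde \<Omega> U = (\<Union>x\<in>U. tensor_class (f_alg \<Omega>)
     (lin_ext (\<lambda>(u, w). Poly_Mapping.single
        (proj \<Omega> (Poly_Mapping.single u 1), proj \<Omega> (Poly_Mapping.single w 1))
        (tt powi (sqf \<Omega> (wt u) (wt w)))) (r \<Omega> x)))"

definition f_star :: "('i::finite \<Rightarrow> 'i \<Rightarrow> int) \<Rightarrow> (qvt, 'i fa set) bialg" where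
  "f_star \<Omega> =
     \<lparr>carrier = carrier (f_alg \<Omega>), monoid.mult = star \<Omega>, one = \<one>\<^bsub>f_alg \<Omega>\<^esub>, ring.zero = \<zero>\<^bsub>f_alg \<Omega>\<^esub>,
      add = (\<oplus>\<^bsub>f_alg \<Omega>\<^esub>), module.smult = (\<odot>\<^bsub>f_alg \<Omega>\<^esub>), comult = rtilde \<Omega>\<rparr>"

text \<open>On homogeneous elements the word-wise definitions \<open>star_free\<close>, \<open>tmul\<close> and \<open>tensor_form\<close>
  satisfy the formulas by which these operations are usually introduced.\<close>

lemma lin_ext_superset:
  assumes "finite S" "Poly_Mapping.keys p \<subseteq> S"
  shows "lin_ext g p = (\<Sum>k\<in>S. scale (Poly_Mapping.lookup p k) (g k))"
  unfolding lin_ext_def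
  by (rule sum.mono_neutral_left) (use assms in \<open>auto simp: in_keys_iff\<close>)

lemma lin_ext_single [simp]: "lin_ext g (Poly_Mapping.single k c) = scale c (g k)"
  by (subst lin_ext_superset[where S = "{k}"]) (auto simp: keys_single)

lemma lin_ext_add: "lin_ext g (p + q) = lin_ext g p + lin_ext g q"
proof -
  let ?S = "Poly_Mapping.keys p \<union> Poly_Mapping.keys q"
  have "Poly_Mapping.keys (p + q) \<subseteq> ?S" by (rule Poly_Mapping.keys_add)
  then show ?thesis
    by (simp add: lin_ext_superset[where S = ?S] lookup_add free.scale_left_distrib sum.distrib)
qed

lemma single_sum: "finite S \<Longrightarrow> Poly_Mapping.keys p \<subseteq> S \<Longrightarrow>
    p = (\<Sum>k\<in>S. Poly_Mapping.single k (Poly_Mapping.lookup p k))"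
  by (rule poly_mapping_eqI)
    (auto simp: lookup_sum lookup_single when_def in_keys_iff)

lemma scale_single [simp]: "scale c (Poly_Mapping.single k d) = Poly_Mapping.single k (c * d)"
  by (rule poly_mapping_eqI) (simp add: lookup_single when_def)

lemma fa_mult_expand: "(x :: 'i fa) * y = (\<Sum>u\<in>Poly_Mapping.keys x. \<Sum>w\<in>Poly_Mapping.keys y.
    Poly_Mapping.single (u @ w) (Poly_Mapping.lookup x u * Poly_Mapping.lookup y w))"
proof -
  have "x * y = (\<Sum>u\<in>Poly_Mapping.keys x. Poly_Mapping.single u (Poly_Mapping.lookup x u)) *
                (\<Sum>w\<in>Poly_Mapping.keys y. Poly_Mapping.single w (Poly_Mapping.lookup y w))"
    using single_sum[of "Poly_Mapping.keys x" x] single_sum[of "Poly_Mapping.keys y" y] by simp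
  then show ?thesis
    by (simp add: sum_product mult_single plus_list_def)
qed

lemma lookup_tensor [simp]:
  "Poly_Mapping.lookup (tensor x y) (u, w) = Poly_Mapping.lookup x u * Poly_Mapping.lookup y w"
proof -
  have "Poly_Mapping.lookup (tensor x y) (u, w) =
     (\<Sum>a\<in>Poly_Mapping.keys x. \<Sum>b\<in>Poly_Mapping.keys y.
        if a = u \<and> b = w then Poly_Mapping.lookup x a * Poly_Mapping.lookup y b else 0)"
    unfolding tensor_def lin_ext_def
    by (auto simp: lookup_sum lookup_single when_def sum_distrib_left intro!: sum.cong)
  also have "\<dots> = (\<Sum>a\<in>Poly_Mapping.keys x. if a = u then
       (\<Sum>b\<in>Poly_Mapping.keys y. if b = w then Poly_Mapping.lookup x a * Poly_Mapping.lookup y b else 0) else 0)"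
    by (intro sum.cong) auto
  finally show ?thesis by (auto simp: in_keys_iff)
qed

lemma keys_tensor: "Poly_Mapping.keys (tensor x y) = Poly_Mapping.keys x \<times> Poly_Mapping.keys y"
  by (auto simp: in_keys_iff)

lemma star_free_homogeneous:
  assumes "homogeneous \<mu> x" "homogeneous \<nu> y"
  shows "star_free \<Omega> x y = scale (tt powi (- sqf \<Omega> \<mu> \<nu>)) (x * y)"
proof -
  have "star_free \<Omega> x y = (\<Sum>u\<in>Poly_Mapping.keys x. \<Sum>w\<in>Poly_Mapping.keys y.
     Poly_Mapping.single (u @ w)
       (tt powi (- sqf \<Omega> \<mu> \<nu>) * (Poly_Mapping.lookup x u * Poly_Mapping.lookup y w)))"
    unfolding star_free_def lin_ext_def free.scale_sum_right
    using assms by (intro sum.cong) (simp_all add: homogeneous_def mult_ac)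
  then show ?thesis
    by (simp add: fa_mult_expand free.scale_sum_right)
qed

lemma tensor_expand: "tensor x y = (\<Sum>u\<in>Poly_Mapping.keys x. \<Sum>w\<in>Poly_Mapping.keys y.
    Poly_Mapping.single (u, w) (Poly_Mapping.lookup x u * Poly_Mapping.lookup y w))"
  unfolding tensor_def lin_ext_def by (simp add: free.scale_sum_right)

lemma tensor_sum_left: "tensor (\<Sum>a\<in>A. f a) y = (\<Sum>a\<in>A. tensor (f a) y)"
  by (rule poly_mapping_eqI) (auto simp: lookup_sum sum_distrib_right)

lemma tensor_sum_right: "tensor x (\<Sum>a\<in>A. f a) = (\<Sum>a\<in>A. tensor x (f a))"
  by (rule poly_mapping_eqI) (auto simp: lookup_sum sum_distrib_left)

lemma tensor_single: "tensor (Poly_Mapping.single u a) (Poly_Mapping.single w b) =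
    Poly_Mapping.single (u, w) (a * b)"
  by (rule poly_mapping_eqI) (auto simp: lookup_single when_def split: if_splits)

lemma tmul_homogeneous:
  assumes "homogeneous \<nu> x2" "homogeneous \<mu> y1"
  shows "tmul \<Omega> (tensor x1 x2) (tensor y1 y2) =
    scale (vv powi (- dotf \<Omega> \<mu> \<nu>) * tt powi (ang \<Omega> \<mu> \<nu> - ang \<Omega> \<nu> \<mu>))
      (tensor (x1 * y1) (x2 * y2))"
proof -
  define c where "c = vv powi (- dotf \<Omega> \<mu> \<nu>) * tt powi (ang \<Omega> \<mu> \<nu> - ang \<Omega> \<nu> \<mu>)"
  have c: "vv powi (- dotf \<Omega> (wt d) (wt b)) * tt powi (ang \<Omega> (wt d) (wt b) - ang \<Omega> (wt b) (wt d)) = c"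
    if "b \<in> Poly_Mapping.keys x2" "d \<in> Poly_Mapping.keys y1" for b d
    using assms that by (simp add: homogeneous_def c_def)
  have "tmul \<Omega> (tensor x1 x2) (tensor y1 y2) =
    (\<Sum>a\<in>Poly_Mapping.keys x1. \<Sum>b\<in>Poly_Mapping.keys x2.
     \<Sum>d\<in>Poly_Mapping.keys y1. \<Sum>e\<in>Poly_Mapping.keys y2.
      Poly_Mapping.single (a @ d, b @ e) (c * (
        (Poly_Mapping.lookup x1 a * Poly_Mapping.lookup y1 d) *
        (Poly_Mapping.lookup x2 b * Poly_Mapping.lookup y2 e))))"
    unfolding tmul_def lin_ext_def keys_tensor sum.cartesian_product' case_prod_conv
      free.scale_sum_right scale_single lookup_tensor
    by (intro sum.cong refl) (simp only: c mult_ac)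
  also have "\<dots> = (\<Sum>a\<in>Poly_Mapping.keys x1. \<Sum>d\<in>Poly_Mapping.keys y1.
     \<Sum>b\<in>Poly_Mapping.keys x2. \<Sum>e\<in>Poly_Mapping.keys y2.
      Poly_Mapping.single (a @ d, b @ e) (c * (
        (Poly_Mapping.lookup x1 a * Poly_Mapping.lookup y1 d) *
        (Poly_Mapping.lookup x2 b * Poly_Mapping.lookup y2 e))))"
    by (intro sum.cong refl sum.swap)
  also have "\<dots> = scale c (tensor (x1 * y1) (x2 * y2))"
    unfolding fa_mult_expand tensor_sum_left
    unfolding tensor_sum_right free.scale_sum_right tensor_single scale_single ..
  finally show ?thesis by (simp only: c_def)
qed

lemma linear_expand:
  assumes "Vector_Spaces.linear scale (*) f"
  shows "f x = (\<Sum>k\<in>Poly_Mapping.keys x. Poly_Mapping.lookup x k * f (Poly_Mapping.single k 1))"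
proof -
  interpret Vector_Spaces.linear scale "(*)" f by (rule assms)
  have "x = (\<Sum>k\<in>Poly_Mapping.keys x. scale (Poly_Mapping.lookup x k) (Poly_Mapping.single k 1))"
    using single_sum[of "Poly_Mapping.keys x" x] by simp
  then have "f x = f (\<Sum>k\<in>Poly_Mapping.keys x. scale (Poly_Mapping.lookup x k) (Poly_Mapping.single k 1))"
    by (rule arg_cong)
  then show ?thesis by (simp only: sum scale)
qed

lemma bilinear_form_expand:
  assumes "bilinear_form B"
  shows "B x y = (\<Sum>u\<in>Poly_Mapping.keys x. \<Sum>w\<in>Poly_Mapping.keys y.
      Poly_Mapping.lookup x u * Poly_Mapping.lookup y w *
      B (Poly_Mapping.single u 1) (Poly_Mapping.single w 1))"
proof -
  have l: "Vector_Spaces.linear scale (*) (\<lambda>y. B x y)"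
    and r: "Vector_Spaces.linear scale (*) (\<lambda>x. B x y)" for x y
    using assms by (simp_all add: bilinear_form_def)
  have "B x y = (\<Sum>u\<in>Poly_Mapping.keys x. Poly_Mapping.lookup x u * B (Poly_Mapping.single u 1) y)"
    by (rule linear_expand[OF r])
  also have "\<dots> = (\<Sum>u\<in>Poly_Mapping.keys x. \<Sum>w\<in>Poly_Mapping.keys y.
      Poly_Mapping.lookup x u * Poly_Mapping.lookup y w *
      B (Poly_Mapping.single u 1) (Poly_Mapping.single w 1))"
    by (subst linear_expand[OF l]) (simp add: sum_distrib_left mult.assoc)
  finally show ?thesis .
qed

lemma tensor_form_homogeneous:
  assumes "bilinear_form B" "homogeneous \<mu> x1" "homogeneous \<nu> x2"
  shows "tensor_form \<Omega> B (tensor x1 x2) (tensor y1 y2) =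
    tt powi (2 * sqf \<Omega> \<mu> \<nu>) * B x1 y1 * B x2 y2"
proof -
  define c where "c = tt powi (2 * sqf \<Omega> \<mu> \<nu>)"
  have c: "tt powi (2 * sqf \<Omega> (wt a) (wt b)) = c"
    if "a \<in> Poly_Mapping.keys x1" "b \<in> Poly_Mapping.keys x2" for a b
    using assms that by (simp add: homogeneous_def c_def)
  have "tensor_form \<Omega> B (tensor x1 x2) (tensor y1 y2) =
    (\<Sum>a\<in>Poly_Mapping.keys x1. \<Sum>b\<in>Poly_Mapping.keys x2.
     \<Sum>d\<in>Poly_Mapping.keys y1. \<Sum>e\<in>Poly_Mapping.keys y2.
      c * (Poly_Mapping.lookup x1 a * Poly_Mapping.lookup y1 d *
        B (Poly_Mapping.single a 1) (Poly_Mapping.single d 1)) *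
      (Poly_Mapping.lookup x2 b * Poly_Mapping.lookup y2 e *
        B (Poly_Mapping.single b 1) (Poly_Mapping.single e 1)))"
    unfolding tensor_form_def keys_tensor sum.cartesian_product' case_prod_conv lookup_tensor
    by (intro sum.cong refl) (simp only: c mult_ac)
  also have "\<dots> = (\<Sum>a\<in>Poly_Mapping.keys x1. \<Sum>d\<in>Poly_Mapping.keys y1.
     \<Sum>b\<in>Poly_Mapping.keys x2. \<Sum>e\<in>Poly_Mapping.keys y2.
      c * (Poly_Mapping.lookup x1 a * Poly_Mapping.lookup y1 d *
        B (Poly_Mapping.single a 1) (Poly_Mapping.single d 1)) *
      (Poly_Mapping.lookup x2 b * Poly_Mapping.lookup y2 e *
        B (Poly_Mapping.single b 1) (Poly_Mapping.single e 1)))"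
    by (intro sum.cong refl sum.swap)
  also have "\<dots> = c * B x1 y1 * B x2 y2"
    by (simp only: sum_distrib_left[symmetric] sum_distrib_right[symmetric]
        bilinear_form_expand[OF assms(1), symmetric])
  finally show ?thesis by (simp only: c_def)
qed

end

theory Submission
  imports Defs
begin

text \<open>In the basis of \<open>*\<close>-products of letters the values of the form and the coefficients of the
  rescaled coproduct do not involve \<open>t\<close>: they are those of Lusztig's one-parameter
  algebra and depend on \<open>\<Omega>\<close> only through its Cartan datum. Hence the form exists, and the linear map
  of free algebras which sends \<open>*\<close>-products of letters for \<open>\<Omega>\<close> to those for \<open>\<Omega>'\<close> is an isometry; on words
  it is a rescaling by powers of \<open>t\<close>. It carries radical to radical and cosets to cosets. Since the
  operations on the quotient are unions over representatives, taking images of cosets transports them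
  without using that the radical is an ideal and a coideal.\<close>

section \<open>Lusztig's form on words\<close>

text \<open>Elements \<open>\<Sum> c b\<close> of a space spanned by words are encoded as the functionals
  \<open>f \<mapsto> \<Sum> c * f b\<close>: \<open>skew_deriv q i y\<close> is the \<open>q\<close>-derivation of the word \<open>y\<close> with respect to the
  letter \<open>i\<close>, and \<open>shuffle q w\<close> is the coproduct of \<open>w\<close>.\<close>

primrec skew_deriv ::
  "('i \<Rightarrow> 'i \<Rightarrow> 'k::field) \<Rightarrow> 'i \<Rightarrow> 'i list \<Rightarrow> ('i list \<Rightarrow> 'k) \<Rightarrow> 'k" where
  "skew_deriv q i [] f = 0"
| "skew_deriv q i (j # y) f = (if i = j then f y else 0) + q i j * skew_deriv q i y (\<lambda>b. f (j # b))"

primrec shuffle ::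
  "('i \<Rightarrow> 'i \<Rightarrow> 'k::field) \<Rightarrow> 'i list \<Rightarrow> ('i list \<Rightarrow> 'i list \<Rightarrow> 'k) \<Rightarrow> 'k" where
  "shuffle q [] f = f [] []"
| "shuffle q (j # w) f = shuffle q w (\<lambda>a b. f (j # a) b) +
     shuffle q w (\<lambda>a b. (\<Prod>i\<leftarrow>a. q i j) * f a (j # b))"

text \<open>Lusztig's adjunction between left multiplication by a letter and the skew derivation,
  used as a recursion; \<open>c i\<close> is the value of the form on the letter \<open>i\<close>
  with itself.\<close>

primrec word_form ::
  "('i \<Rightarrow> 'i \<Rightarrow> 'k::field) \<Rightarrow> ('i \<Rightarrow> 'k) \<Rightarrow> 'i list \<Rightarrow> 'i list \<Rightarrow> 'k" where
  "word_form q c [] y = (if y = [] then 1 else 0)"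
| "word_form q c (i # x) y = c i * skew_deriv q i y (word_form q c x)"

section \<open>Linearity, support and symmetry of the word functionals\<close>

lemma skew_deriv_0 [simp]: "skew_deriv q i y (\<lambda>_. 0) = 0"
  by (induction y) auto

lemma skew_deriv_add: "skew_deriv q i y (\<lambda>b. f b + g b) = skew_deriv q i y f + skew_deriv q i y g"
  by (induction y arbitrary: f g) (auto simp: algebra_simps)

lemma skew_deriv_cmult: "skew_deriv q i y (\<lambda>b. d * f b) = d * skew_deriv q i y f"
  by (induction y arbitrary: f) (auto simp: algebra_simps)

lemma shuffle_0 [simp]: "shuffle q w (\<lambda>_ _. 0) = 0"
  by (induction w) auto

lemma shuffle_add: "shuffle q w (\<lambda>a b. f a b + g a b) = shuffle q w f + shuffle q w g"
  by (induction w arbitrary: f g) (auto simp: algebra_simps)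

lemma shuffle_cmult: "shuffle q w (\<lambda>a b. d * f a b) = d * shuffle q w f"
  by (induction w arbitrary: f) (auto simp: algebra_simps mult.left_commute[of _ d])

text \<open>The two derivations act on different variables of \<open>F\<close>, so this interchanges
  two finite sums.\<close>

lemma skew_deriv_commute:
  "skew_deriv q i y (\<lambda>b. skew_deriv q j x (\<lambda>z. F z b)) =
   skew_deriv q j x (\<lambda>z. skew_deriv q i y (\<lambda>b. F z b))"
  by (induction y arbitrary: F) (auto simp: skew_deriv_add skew_deriv_cmult)

text \<open>Each word in the derivation of \<open>y\<close> arises by deleting one letter
  \<open>i\<close>, so only such words matter.\<close>

lemma skew_deriv_eq_0:
  assumes "\<And>b. mset y = add_mset i (mset b) \<Longrightarrow> f b = 0"
  shows "skew_deriv q i y f = 0"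
  using assms
proof (induction y arbitrary: f)
  case (Cons j y)
  have "skew_deriv q i y (\<lambda>b. f (j # b)) = 0"
    by (rule Cons.IH) (simp add: Cons.prems add_mset_commute)
  then show ?case by (simp add: Cons.prems)
qed simp

lemma skew_deriv_cong:
  assumes "\<And>b. mset y = add_mset i (mset b) \<Longrightarrow> f b = g b"
  shows "skew_deriv q i y f = skew_deriv q i y g"
proof -
  have "skew_deriv q i y (\<lambda>b. f b + (-1) * g b) = 0"
    by (rule skew_deriv_eq_0) (simp add: assms)
  then show ?thesis by (simp only: skew_deriv_add skew_deriv_cmult) simp
qed

text \<open>Every step of the recursion removes the same letter from both arguments. Later this
  allows weights to be exchanged wherever the form is nonzero.\<close>

lemma word_form_eq_0: "mset x \<noteq> mset y \<Longrightarrow> word_form q c x y = 0"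
proof (induction x arbitrary: y)
  case (Cons i x)
  have "skew_deriv q i y (word_form q c x) = 0"
    by (rule skew_deriv_eq_0, rule Cons.IH) (use Cons.prems in auto)
  then show ?case by simp
qed auto

text \<open>The mirror image of the defining recursion. The two derivations commute, and symmetry of
  \<open>q\<close> matches the scalars produced when the two first letters pass each other.\<close>

lemma word_form_Cons_right:
  assumes "\<And>i j. q i j = q j i"
  shows "word_form q c x (j # y) = c j * skew_deriv q j x (\<lambda>z. word_form q c z y)"
proof (induction x arbitrary: y)
  case (Cons i x)
  have "skew_deriv q i y (\<lambda>b. word_form q c x (j # b)) =
      skew_deriv q i y (\<lambda>b. c j * skew_deriv q j x (\<lambda>z. word_form q c z b))"
    by (simp only: Cons.IH)
  also have "\<dots> = c j * skew_deriv q j x (\<lambda>z. skew_deriv q i y (word_form q c z))"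
    by (simp add: skew_deriv_cmult skew_deriv_commute[of q i y])
  finally show ?case
    using assms[of i j] by (simp add: skew_deriv_cmult algebra_simps)
qed simp

text \<open>The form and its transpose satisfy the same recursion in the first argument.\<close>

lemma word_form_sym:
  assumes "\<And>i j. q i j = q j i"
  shows "word_form q c x y = word_form q c y x"
proof (induction x arbitrary: y)
  case Nil
  show ?case by (cases y) auto
next
  case (Cons i x)
  have "word_form q c x = (\<lambda>z. word_form q c z x)" using Cons.IH by auto
  then show ?case by (simp add: word_form_Cons_right[OF assms])
qed

text \<open>Coassociativity in the one case needed.\<close>

lemma skew_deriv_shuffle:
  "skew_deriv q i y (\<lambda>z. shuffle q z f) = shuffle q y (\<lambda>a b. skew_deriv q i a (\<lambda>a'. f a' b))"
proof (induction y arbitrary: f)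
  case (Cons j y)
  \<comment> \<open>Moving \<open>j\<close> past \<open>a\<close> costs \<open>q i j\<close> more
    than moving it past \<open>a'\<close>, which is \<open>a\<close> with one letter
    \<open>i\<close> deleted.\<close>
  have wt: "(\<Prod>k\<leftarrow>a. q k j) * skew_deriv q i a (\<lambda>a'. f a' (j # b)) =
      q i j * skew_deriv q i a (\<lambda>a'. (\<Prod>k\<leftarrow>a'. q k j) * f a' (j # b))" for a b
  proof -
    have "(\<Prod>k\<leftarrow>a. q k j) = q i j * (\<Prod>k\<leftarrow>a'. q k j)" if "mset a = add_mset i (mset a')" for a'
      using that by (simp flip: prod_mset_prod_list)
    then show ?thesis
      unfolding skew_deriv_cmult[symmetric] mult.assoc[symmetric]
      by (intro skew_deriv_cong) simp
  qed
  have "skew_deriv q i (j # y) (\<lambda>z. shuffle q z f) = (if i = j then shuffle q y f else 0) +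
      q i j * skew_deriv q i y (\<lambda>z. shuffle q z (\<lambda>a b. f (j # a) b)) +
      q i j * skew_deriv q i y (\<lambda>z. shuffle q z (\<lambda>a b. (\<Prod>k\<leftarrow>a. q k j) * f a (j # b)))"
    by (simp only: skew_deriv.simps shuffle.simps skew_deriv_add distrib_left add.assoc)
  also have "\<dots> = shuffle q (j # y) (\<lambda>a b. skew_deriv q i a (\<lambda>a'. f a' b))"
    unfolding Cons.IH shuffle.simps skew_deriv.simps shuffle_add wt shuffle_cmult by simp
  finally show ?case .
qed simp

text \<open>The counit property: the left factor is empty only if all letters go right, and then the
  braiding scalars are empty products.\<close>

lemma shuffle_Nil_left: "shuffle q y (\<lambda>a b. if a = [] then f b else 0) = f y"
proof (induction y arbitrary: f)
  case (Cons j y)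
  have "(\<lambda>a b. (\<Prod>k\<leftarrow>a. q k j) * (if a = [] then f (j # b) else 0)) =
      (\<lambda>a b. if a = [] then f (j # b) else 0)" by (auto simp: fun_eq_iff)
  then show ?case by (simp add: Cons.IH)
qed simp

text \<open>Adjointness of product and coproduct. Peeling off the first letter of the left factor
  leaves a derivation of \<open>y\<close>, which coassociativity moves to the left tensor
  factor.\<close>

lemma word_form_append:
  "word_form q c (x @ x') y = shuffle q y (\<lambda>a b. word_form q c x a * word_form q c x' b)"
proof (induction x arbitrary: y)
  case Nil
  have "(\<lambda>a b. word_form q c [] a * word_form q c x' b) =
      (\<lambda>a b. if a = [] then word_form q c x' b else 0)" by auto
  then show ?case by (simp only: shuffle_Nil_left append_Nil)
next
  case (Cons i x)
  have "word_form q c ((i # x) @ x') y =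
      c i * skew_deriv q i y (\<lambda>z. shuffle q z (\<lambda>a b. word_form q c x a * word_form q c x' b))"
    by (simp add: Cons.IH[abs_def])
  also have "\<dots> = shuffle q y (\<lambda>a b. word_form q c (i # x) a * word_form q c x' b)"
    unfolding skew_deriv_shuffle shuffle_cmult[symmetric]
    by (simp add: skew_deriv_cmult[symmetric] mult_ac)
  finally show ?case .
qed

section \<open>Evaluation of linear functionals\<close>

text \<open>The scalar-valued counterpart of \<open>lin_ext\<close>. Iterated, it expresses bilinear
  forms and coefficients of coproducts without mention of supports.\<close>

definition eval_lin :: "('a \<Rightarrow> 'k::field) \<Rightarrow> ('a \<Rightarrow>\<^sub>0 'k) \<Rightarrow> 'k" where
  "eval_lin g p = (\<Sum>k\<in>Poly_Mapping.keys p. Poly_Mapping.lookup p k * g k)"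

lemma eval_lin_superset:
  assumes "finite S" "Poly_Mapping.keys p \<subseteq> S"
  shows "eval_lin g p = (\<Sum>k\<in>S. Poly_Mapping.lookup p k * g k)"
  unfolding eval_lin_def
  by (rule sum.mono_neutral_left) (use assms in \<open>auto simp: in_keys_iff\<close>)

lemma eval_lin_single [simp]: "eval_lin g (Poly_Mapping.single k c) = c * g k"
  by (subst eval_lin_superset[where S = "{k}"]) auto

lemma eval_lin_0 [simp]: "eval_lin g 0 = 0"
  by (simp add: eval_lin_def)

lemma eval_lin_add: "eval_lin g (p + p') = eval_lin g p + eval_lin g p'"
proof -
  let ?S = "Poly_Mapping.keys p \<union> Poly_Mapping.keys p'"
  have "Poly_Mapping.keys (p + p') \<subseteq> ?S" by (rule Poly_Mapping.keys_add)
  then show ?thesis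
    by (simp add: eval_lin_superset[where S = ?S] lookup_add algebra_simps sum.distrib)
qed

lemma eval_lin_scale: "eval_lin g (scale c p) = c * eval_lin g p"
proof -
  have "Poly_Mapping.keys (scale c p) \<subseteq> Poly_Mapping.keys p" by (auto simp: in_keys_iff)
  then show ?thesis
    by (simp add: eval_lin_superset[where S = "Poly_Mapping.keys p"] sum_distrib_left mult.assoc)
qed

lemma eval_lin_sum: "eval_lin g (\<Sum>a\<in>A. p a) = (\<Sum>a\<in>A. eval_lin g (p a))"
  by (induction A rule: infinite_finite_induct) (auto simp: eval_lin_add)

lemma eval_lin_lin_ext: "eval_lin g (lin_ext h p) = eval_lin (\<lambda>k. eval_lin g (h k)) p"
  by (simp add: lin_ext_def eval_lin_sum eval_lin_scale eval_lin_def[of "\<lambda>k. eval_lin g (h k)"])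

lemma lookup_eq_eval_lin: "Poly_Mapping.lookup p k = eval_lin (\<lambda>k'. if k' = k then 1 else 0) p"
  by (simp add: eval_lin_def in_keys_iff if_distrib cong: if_cong)

lemma eval_lin_fun_add: "eval_lin (\<lambda>k. g k + h k) p = eval_lin g p + eval_lin h p"
  by (simp add: eval_lin_def algebra_simps sum.distrib)

lemma eval_lin_fun_cmult: "eval_lin (\<lambda>k. c * g k) p = c * eval_lin g p"
  by (simp add: eval_lin_def sum_distrib_left mult_ac)

lemma eval_lin_swap:
  "eval_lin (\<lambda>a. eval_lin (\<lambda>b. F a b) y) x = eval_lin (\<lambda>b. eval_lin (\<lambda>a. F a b) x) y"
  unfolding eval_lin_def sum_distrib_left
  by (subst sum.swap) (simp add: mult_ac)

lemma eval_lin_mult: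
  "eval_lin g (x * y :: 'i fa) = eval_lin (\<lambda>u. eval_lin (\<lambda>w. g (u @ w)) y) x"
  unfolding fa_mult_expand eval_lin_sum eval_lin_single
  by (simp add: eval_lin_def sum_distrib_left mult_ac)

lemma eval_lin_tensor:
  "eval_lin g (tensor x y) = eval_lin (\<lambda>u. eval_lin (\<lambda>w. g (u, w)) y) x"
  unfolding tensor_def by (simp add: eval_lin_lin_ext)

lemma tensor_form_eval_lin:
  "tensor_form \<Omega> B p p' = eval_lin (\<lambda>(x1, x2). eval_lin (\<lambda>(y1, y2).
     tt powi (2 * sqf \<Omega> (wt x1) (wt x2)) *
      B (Poly_Mapping.single x1 1) (Poly_Mapping.single y1 1) *
      B (Poly_Mapping.single x2 1) (Poly_Mapping.single y2 1)) p') p"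
  unfolding tensor_form_def eval_lin_def
  by (auto simp: sum_distrib_left mult.assoc intro!: sum.cong)

section \<open>Weights\<close>

lemma sum_wt_left: "(\<Sum>i\<in>UNIV. wt u i * f i) = (\<Sum>i\<leftarrow>u. f (i::'i::finite))"
proof (induction u)
  case (Cons k u)
  have "(\<Sum>i\<in>UNIV. wt (k # u) i * f i) = (\<Sum>i\<in>UNIV. (if k = i then f i else 0) + wt u i * f i)"
    by (intro sum.cong) (auto simp: wt_def algebra_simps)
  then show ?case by (simp add: sum.distrib Cons.IH)
qed (simp add: wt_def)

text \<open>Turns the bilinear forms on weights into sums over pairs of letters, where additivity is
  immediate by induction on words.\<close>

lemma sum_wt: "(\<Sum>i\<in>UNIV. \<Sum>j\<in>UNIV. wt u (i::'i::finite) * wt w j * M i j) =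
    (\<Sum>i\<leftarrow>u. \<Sum>j\<leftarrow>w. M i (j::'i))"
  by (simp add: mult.assoc sum_wt_left flip: sum_distrib_left)

lemma ang_wt: "ang \<Omega> (wt u) (wt w) = (\<Sum>i\<leftarrow>u. \<Sum>j\<leftarrow>w. \<Omega> i j)"
  unfolding ang_def by (rule sum_wt)

lemma sqf_wt: "sqf \<Omega> (wt u) (wt w) =
    (\<Sum>i\<leftarrow>u. \<Sum>j\<leftarrow>w. (if i = j then 2 * \<Omega> i i else 0) - \<Omega> i j)"
  unfolding sqf_def by (rule sum_wt)

lemma wt_cong: "mset u = mset w \<Longrightarrow> wt u = wt w"
  by (auto simp: wt_def fun_eq_iff simp flip: count_mset)


lemma vv_nonzero [simp]: "vv \<noteq> 0" and tt_nonzero [simp]: "tt \<noteq> 0"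
  by (simp_all add: vv_def tt_def)

lemma one_fa: "(1 :: 'i fa) = Poly_Mapping.single [] 1"
  by (simp flip: single_one add: zero_list_def)

section \<open>The form on the free algebra\<close>

definition qpar :: "('i::finite \<Rightarrow> 'i \<Rightarrow> int) \<Rightarrow> 'i \<Rightarrow> 'i \<Rightarrow> qvt" where
  "qpar \<Omega> i j = vv powi (- (\<Omega> i j + \<Omega> j i))"

definition theta_norm :: "('i::finite \<Rightarrow> 'i \<Rightarrow> int) \<Rightarrow> 'i \<Rightarrow> qvt" where
  "theta_norm \<Omega> i = inverse (1 - (vv powi (dotf \<Omega> (wt [i]) (wt [i]) div 2)) powi (-2))"

text \<open>The word \<open>w\<close> is \<open>t\<close> to the power \<open>word_exp \<Omega> w\<close> times the \<open>*\<close>-product of its letters.\<close>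

primrec word_exp :: "('i::finite \<Rightarrow> 'i \<Rightarrow> int) \<Rightarrow> 'i list \<Rightarrow> int" where
  "word_exp \<Omega> [] = 0"
| "word_exp \<Omega> (i # w) = sqf \<Omega> (wt [i]) (wt w) + word_exp \<Omega> w"

text \<open>Chosen so that the \<open>*\<close>-products of letters pair by Lusztig's form; each
  word then contributes its own power of \<open>t\<close>.\<close>

definition fa_form :: "('i::finite \<Rightarrow> 'i \<Rightarrow> int) \<Rightarrow> 'i fa \<Rightarrow> 'i fa \<Rightarrow> qvt" where
  "fa_form \<Omega> x y = eval_lin (\<lambda>u. eval_lin (\<lambda>w. tt powi (word_exp \<Omega> u + word_exp \<Omega> w) *
     word_form (qpar \<Omega>) (theta_norm \<Omega>) u w) y) x"

lemma qpar_sym: "qpar \<Omega> i j = qpar \<Omega> j i"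
  by (simp add: qpar_def add.commute)

lemma qpar_prod: "(\<Prod>i\<leftarrow>a. qpar \<Omega> i j) = vv powi (- dotf \<Omega> (wt [j]) (wt a))"
  by (induction a) (simp_all add: dotf_def ang_wt qpar_def algebra_simps flip: power_int_add)

text \<open>\<open>word_exp\<close> sums the form over all pairs of positions in order;
  concatenation adds the pairs with one position in each word.\<close>

lemma word_exp_append:
  "word_exp \<Omega> (u @ w) = word_exp \<Omega> u + word_exp \<Omega> w + sqf \<Omega> (wt u) (wt w)"
  by (induction u) (simp_all add: sqf_wt)

lemma eval_lin_tmul:
  "eval_lin g (tmul \<Omega> p p') = eval_lin (\<lambda>(x1, x2). eval_lin (\<lambda>(y1, y2).
     vv powi (- dotf \<Omega> (wt y1) (wt x2)) *
     tt powi (ang \<Omega> (wt y1) (wt x2) - ang \<Omega> (wt x2) (wt y1)) * g (x1 @ y1, x2 @ y2)) p') p"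
  unfolding tmul_def eval_lin_lin_ext by (simp add: case_prod_unfold eval_lin_lin_ext)

lemma shuffle_cong:
  assumes "\<And>a b. mset a + mset b = mset w \<Longrightarrow> f a b = g a b"
  shows "shuffle q w f = shuffle q w g"
  using assms
proof (induction w arbitrary: f g)
  case (Cons j w)
  have "shuffle q w (\<lambda>a b. f (j # a) b) = shuffle q w (\<lambda>a b. g (j # a) b)"
    by (rule Cons.IH) (simp add: Cons.prems)
  moreover have "shuffle q w (\<lambda>a b. (\<Prod>i\<leftarrow>a. q i j) * f a (j # b)) =
      shuffle q w (\<lambda>a b. (\<Prod>i\<leftarrow>a. q i j) * g a (j # b))"
    by (rule Cons.IH) (simp add: Cons.prems)
  ultimately show ?case by simp
qed simp

text \<open>In the basis of \<open>*\<close>-products, and after the rescaling that defines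
  \<open>rtilde\<close>, the coproduct is Lusztig's \<open>shuffle\<close>. The exponent of
  \<open>t\<close> translates this back to words and to the unscaled \<open>r\<close>.\<close>

lemma eval_lin_r_word:
  "eval_lin g (r_word \<Omega> w) = shuffle (qpar \<Omega>) w (\<lambda>a b.
     tt powi (word_exp \<Omega> w - word_exp \<Omega> a - word_exp \<Omega> b - sqf \<Omega> (wt a) (wt b)) * g (a, b))"
proof (induction w arbitrary: g)
  case Nil
  show ?case by (simp add: one_fa tensor_single sqf_wt)
next
  case (Cons i w)
  have sq: "sqf \<Omega> (wt [i]) (wt w) = sqf \<Omega> (wt [i]) (wt a) + sqf \<Omega> (wt [i]) (wt b)"
    if "mset a + mset b = mset w" for a b
    using wt_cong[of w "a @ b"] that by (simp add: sqf_wt)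
  have expand: "eval_lin g (r_word \<Omega> (i # w)) = shuffle (qpar \<Omega>) w (\<lambda>a b.
      tt powi (word_exp \<Omega> w - word_exp \<Omega> a - word_exp \<Omega> b - sqf \<Omega> (wt a) (wt b)) * g (i # a, b)) +
    shuffle (qpar \<Omega>) w (\<lambda>a b.
      tt powi (word_exp \<Omega> w - word_exp \<Omega> a - word_exp \<Omega> b - sqf \<Omega> (wt a) (wt b)) *
      (vv powi (- dotf \<Omega> (wt a) (wt [i])) *
       tt powi (ang \<Omega> (wt a) (wt [i]) - ang \<Omega> (wt [i]) (wt a)) * g (a, i # b)))"
    by (simp add: eval_lin_tmul eval_lin_add theta_def one_fa tensor_single Cons.IH case_prod_unfold
        dotf_def ang_wt)
  \<comment> \<open>The two forms sum to a symmetric form, so their antisymmetrizations are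
    opposite. Hence the \<open>t\<close>-twist of the tensor product can be absorbed by a
    rescaling.\<close>
  have antisym: "ang \<Omega> (wt a) (wt [i]) - ang \<Omega> (wt [i]) (wt a) =
      sqf \<Omega> (wt [i]) (wt a) - sqf \<Omega> (wt a) (wt [i])" for a
    by (induction a) (simp_all add: ang_wt sqf_wt)
  have left: "sqf \<Omega> (wt (i # a)) (wt b) = sqf \<Omega> (wt [i]) (wt b) + sqf \<Omega> (wt a) (wt b)" for a b
    by (simp add: sqf_wt)
  have right: "sqf \<Omega> (wt a) (wt (i # b)) = sqf \<Omega> (wt a) (wt [i]) + sqf \<Omega> (wt a) (wt b)" for a b
    by (induction a) (simp_all add: sqf_wt)
  show ?case
    unfolding expand shuffle.simps
  proof (intro arg_cong2[of _ _ _ _ "(+)"] shuffle_cong)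
    fix a b assume ab: "mset a + mset b = mset w"
    show "tt powi (word_exp \<Omega> w - word_exp \<Omega> a - word_exp \<Omega> b - sqf \<Omega> (wt a) (wt b)) * g (i # a, b) =
      tt powi (word_exp \<Omega> (i # w) - word_exp \<Omega> (i # a) - word_exp \<Omega> b - sqf \<Omega> (wt (i # a)) (wt b)) *
        g (i # a, b)"
      unfolding left[of a b] word_exp.simps sq[OF ab] by (simp add: algebra_simps)
    have "tt powi (word_exp \<Omega> w - word_exp \<Omega> a - word_exp \<Omega> b - sqf \<Omega> (wt a) (wt b)) *
        tt powi (ang \<Omega> (wt a) (wt [i]) - ang \<Omega> (wt [i]) (wt a)) =
      tt powi (word_exp \<Omega> (i # w) - word_exp \<Omega> a - word_exp \<Omega> (i # b) - sqf \<Omega> (wt a) (wt (i # b)))"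
      unfolding right[of a b] antisym[of a] word_exp.simps sq[OF ab]
      by (simp add: algebra_simps flip: power_int_add)
    then show "tt powi (word_exp \<Omega> w - word_exp \<Omega> a - word_exp \<Omega> b - sqf \<Omega> (wt a) (wt b)) *
        (vv powi (- dotf \<Omega> (wt a) (wt [i])) *
         tt powi (ang \<Omega> (wt a) (wt [i]) - ang \<Omega> (wt [i]) (wt a)) * g (a, i # b)) =
      (\<Prod>k\<leftarrow>a. qpar \<Omega> k i) *
        (tt powi (word_exp \<Omega> (i # w) - word_exp \<Omega> a - word_exp \<Omega> (i # b) - sqf \<Omega> (wt a) (wt (i # b))) *
         g (a, i # b))"
      by (simp add: qpar_prod dotf_def add.commute mult_ac)
  qed
qed

section \<open>Existence of the form\<close>

lemma bilinear_fa_form: "bilinear_form (fa_form \<Omega>)"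
proof -
  have "vector_space ((*) :: qvt \<Rightarrow> qvt \<Rightarrow> qvt)"
    by unfold_locales (auto simp: algebra_simps)
  then show ?thesis
    unfolding bilinear_form_def fa_form_def Vector_Spaces.linear_iff
    by (simp add: free.vector_space_axioms eval_lin_add eval_lin_scale eval_lin_fun_add eval_lin_fun_cmult)
qed

lemma fa_form_single [simp]:
  "fa_form \<Omega> (Poly_Mapping.single u a) (Poly_Mapping.single w b) =
   a * b * tt powi (word_exp \<Omega> u + word_exp \<Omega> w) * word_form (qpar \<Omega>) (theta_norm \<Omega>) u w"
  by (simp add: fa_form_def)

lemma fa_form_eval_lin: "fa_form \<Omega> x y = eval_lin (\<lambda>u. eval_lin (\<lambda>w.
    fa_form \<Omega> (Poly_Mapping.single u 1) (Poly_Mapping.single w 1)) y) x"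
  by (simp add: fa_form_def)

lemma fa_form_sym: "fa_form \<Omega> x y = fa_form \<Omega> y x"
  unfolding fa_form_def
  by (subst eval_lin_swap) (simp add: add.commute word_form_sym[of "qpar \<Omega>", OF qpar_sym])

text \<open>Where the form is nonzero, \<open>a\<close> and \<open>b\<close> have the weights of
  \<open>u\<close> and \<open>w\<close>. The doubled exponent in \<open>tensor_form\<close> and the
  negative one from the coproduct then leave the single cross term of
  \<open>word_exp_append\<close>.\<close>

lemma fa_form_append:
  "fa_form \<Omega> (Poly_Mapping.single (u @ w) 1) (Poly_Mapping.single y 1) =
   tensor_form \<Omega> (fa_form \<Omega>) (Poly_Mapping.single (u, w) 1) (r_word \<Omega> y)"
proof -
  let ?L = "word_form (qpar \<Omega>) (theta_norm \<Omega>)"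
  have eq: "tt powi (word_exp \<Omega> (u @ w) + word_exp \<Omega> y) * (?L u a * ?L w b) =
     tt powi (word_exp \<Omega> y - word_exp \<Omega> a - word_exp \<Omega> b - sqf \<Omega> (wt a) (wt b)) *
     (tt powi (2 * sqf \<Omega> (wt u) (wt w)) * (tt powi (word_exp \<Omega> u + word_exp \<Omega> a) * ?L u a) *
      (tt powi (word_exp \<Omega> w + word_exp \<Omega> b) * ?L w b))" for a b
  proof (cases "mset u = mset a \<and> mset w = mset b")
    case True
    then have "wt a = wt u" "wt b = wt w" by (auto intro: wt_cong)
    then have "tt powi (word_exp \<Omega> (u @ w) + word_exp \<Omega> y) =
      tt powi (word_exp \<Omega> y - word_exp \<Omega> a - word_exp \<Omega> b - sqf \<Omega> (wt a) (wt b)) *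
      tt powi (2 * sqf \<Omega> (wt u) (wt w)) *
      tt powi (word_exp \<Omega> u + word_exp \<Omega> a) * tt powi (word_exp \<Omega> w + word_exp \<Omega> b)"
      by (simp add: word_exp_append algebra_simps flip: power_int_add)
    then show ?thesis by (simp add: mult_ac)
  qed (auto simp: word_form_eq_0)
  show ?thesis
    by (simp add: tensor_form_eval_lin eval_lin_r_word word_form_append eq mult.assoc
        flip: shuffle_cmult)
qed

text \<open>The power of \<open>t\<close> refers to the weights of the first argument only; the
  symmetry holds because a nonzero term forces equal weights in both arguments.\<close>

lemma tensor_form_fa_form_sym:
  "tensor_form \<Omega> (fa_form \<Omega>) p p' = tensor_form \<Omega> (fa_form \<Omega>) p' p"
proof -
  have "tt powi (2 * sqf \<Omega> (wt a) (wt b)) *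
      fa_form \<Omega> (Poly_Mapping.single a 1) (Poly_Mapping.single d 1) *
      fa_form \<Omega> (Poly_Mapping.single b 1) (Poly_Mapping.single e 1) =
    tt powi (2 * sqf \<Omega> (wt d) (wt e)) *
      fa_form \<Omega> (Poly_Mapping.single d 1) (Poly_Mapping.single a 1) *
      fa_form \<Omega> (Poly_Mapping.single e 1) (Poly_Mapping.single b 1)" for a b d e
  proof (cases "mset a = mset d \<and> mset b = mset e")
    case True
    then have "wt a = wt d" "wt b = wt e" by (auto intro: wt_cong)
    then show ?thesis by (simp only: fa_form_sym[of \<Omega> "Poly_Mapping.single d 1"]
          fa_form_sym[of \<Omega> "Poly_Mapping.single e 1"])
  qed (auto simp: word_form_eq_0)
  then show ?thesis
    unfolding tensor_form_eval_lin case_prod_unfold by (subst eval_lin_swap) (simp only:)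
qed

lemma fa_form_mult:
  "fa_form \<Omega> (x * x') y = tensor_form \<Omega> (fa_form \<Omega>) (tensor x x') (r \<Omega> y)"
proof -
  have "fa_form \<Omega> (x * x') y = eval_lin (\<lambda>u. eval_lin (\<lambda>w. eval_lin (\<lambda>z.
      tensor_form \<Omega> (fa_form \<Omega>) (Poly_Mapping.single (u, w) 1) (r_word \<Omega> z)) y) x') x"
    by (subst fa_form_eval_lin) (simp only: eval_lin_mult fa_form_append)
  also have "\<dots> = tensor_form \<Omega> (fa_form \<Omega>) (tensor x x') (r \<Omega> y)"
    unfolding r_def tensor_form_eval_lin eval_lin_tensor eval_lin_lin_ext by simp
  finally show ?thesis .
qed

lemma is_form_fa_form: "is_form \<Omega> (fa_form \<Omega>)"
  unfolding is_form_def
proof (intro conjI allI)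
  show "fa_form \<Omega> 1 1 = 1" by (simp add: one_fa)
  show "fa_form \<Omega> (theta i) (theta j) = (if i = j
      then inverse (1 - (vv powi (dotf \<Omega> (wt [i]) (wt [i]) div 2)) powi (-2)) else 0)" for i j
    by (simp add: theta_def theta_norm_def sqf_wt)
  \<comment> \<open>The right adjunction is the left one transposed, by symmetry of both
    forms.\<close>
  show "fa_form \<Omega> x (y' * y'') = tensor_form \<Omega> (fa_form \<Omega>) (r \<Omega> x) (tensor y' y'')" for x y' y''
    by (subst fa_form_sym) (simp only: fa_form_mult tensor_form_fa_form_sym[of \<Omega> "r \<Omega> x"])
qed (rule bilinear_fa_form fa_form_sym fa_form_mult)+

text \<open>The left adjunction reduces a word to its first letter and its tail, so it suffices that
  the axioms force the values of the empty word and of a letter against every word.\<close>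

lemma is_form_unique:
  assumes "is_form \<Omega> B" "is_form \<Omega> B'"
  shows "B = B'"
proof -
  let ?s = "\<lambda>w. Poly_Mapping.single w (1::qvt)"
  have Nil_Nil: "C (?s []) (?s []) = 1"
    and theta_theta: "C (?s [i]) (?s [j]) =
      (if i = j then inverse (1 - (vv powi (dotf \<Omega> (wt [i]) (wt [i]) div 2)) powi (-2)) else 0)"
    and sym: "C x y = C y x"
    and right: "C x (y' * y'') = tensor_form \<Omega> C (r \<Omega> x) (tensor y' y'')"
    and left: "C (x' * x'') y = tensor_form \<Omega> C (tensor x' x'') (r \<Omega> y)"
    if "is_form \<Omega> C" for C i j x y y' y'' x' x''
    using that unfolding is_form_def one_fa theta_def by blast+
  have cons: "C (?s (i # w)) (?s y) = eval_lin (\<lambda>(a, b). tt powi (2 * sqf \<Omega> (wt [i]) (wt w)) *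
      C (?s [i]) (?s a) * C (?s w) (?s b)) (r_word \<Omega> y)" if "is_form \<Omega> C" for C i w y
    using left[OF that, of "?s [i]" "?s w" "?s y"]
    by (simp add: mult_single plus_list_def tensor_single r_def tensor_form_eval_lin)
  have theta_Nil: "C (?s [i]) (?s []) = 0" if "is_form \<Omega> C" for C i
  proof -
    \<comment> \<open>Write the unit as \<open>1 * 1\<close>: both summands of the coproduct of a
      letter give the same value.\<close>
    have "C (?s [i]) (?s []) = 2 * C (?s [i]) (?s [])"
      using right[OF that, of "?s [i]" "?s []" "?s []"] Nil_Nil[OF that]
      by (simp add: mult_single plus_list_def tensor_single r_def tensor_form_eval_lin
          eval_lin_r_word sqf_wt del: r_word.simps)
    then show ?thesis by simp
  qed
  have Nil_Cons: "C (?s []) (?s (i # w)) = 0" if "is_form \<Omega> C" for C i w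
  proof -
    have "C (?s []) (?s (i # w)) = C (?s (i # w)) (?s [])" by (rule sym[OF that])
    also have "\<dots> = 0"
      by (simp add: cons[OF that, of i w "[]"] theta_Nil[OF that] one_fa tensor_single)
    finally show ?thesis .
  qed
  \<comment> \<open>In both summands of the coproduct of a letter, the empty word meets a nonempty
    one.\<close>
  have theta_Cons: "C (?s [i]) (?s (j # k # y)) = 0" if "is_form \<Omega> C" for C i j k y
  proof -
    have "C (?s [i]) (?s (j # k # y)) = tensor_form \<Omega> C (r \<Omega> (?s [i])) (tensor (?s [j]) (?s (k # y)))"
      using right[OF that, of "?s [i]" "?s [j]" "?s (k # y)"]
      by (simp add: mult_single plus_list_def)
    also have "\<dots> = 0"
      by (simp add: tensor_single r_def tensor_form_eval_lin eval_lin_r_word Nil_Cons[OF that]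
          del: r_word.simps)
    finally show ?thesis .
  qed
  have "B (?s w) (?s y) = B' (?s w) (?s y)" for w y
  proof (induction w arbitrary: y)
    case Nil
    show ?case by (cases y) (simp_all add: Nil_Nil Nil_Cons assms)
  next
    case (Cons i w)
    have "B (?s [i]) (?s a) = B' (?s [i]) (?s a)" for a
    proof (cases a)
      case (Cons j a')
      then show ?thesis by (cases a') (simp_all add: theta_Cons theta_theta assms)
    qed (simp add: theta_Nil assms)
    then show ?case
      unfolding cons[OF assms(1), of i w y] cons[OF assms(2), of i w y] by (simp add: Cons.IH)
  qed
  moreover have bil: "bilinear_form B" "bilinear_form B'"
    using assms by (simp_all add: is_form_def)
  ultimately have "B x y = B' x y" for x y
    unfolding bilinear_form_expand[OF bil(1), of x y] bilinear_form_expand[OF bil(2), of x y]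
    by simp
  then show ?thesis by blast
qed

lemma form_eq: "form \<Omega> = fa_form \<Omega>"
  unfolding form_def
  by (rule the_equality, rule is_form_fa_form, erule is_form_unique, rule is_form_fa_form)

section \<open>Tensor squares\<close>

lemma lin_ext_0 [simp]: "lin_ext g 0 = 0"
  by (simp add: lin_ext_def)

lemma lin_ext_scale: "lin_ext g (scale c p) = scale c (lin_ext g p)"
proof -
  have "Poly_Mapping.keys (scale c p) \<subseteq> Poly_Mapping.keys p" by (auto simp: in_keys_iff)
  then show ?thesis
    by (simp add: lin_ext_superset[where S = "Poly_Mapping.keys p"] free.scale_sum_right)
qed

lemma lin_ext_diff: "lin_ext g (p - p') = lin_ext g p - lin_ext g p'"
  using lin_ext_add[of g "p - p'" p'] by simp

lemma lin_ext_sum: "lin_ext g (\<Sum>a\<in>A. p a) = (\<Sum>a\<in>A. lin_ext g (p a))"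
  by (induction A rule: infinite_finite_induct) (auto simp: lin_ext_add)

lemma lin_ext_lin_ext: "lin_ext g (lin_ext h p) = lin_ext (\<lambda>k. lin_ext g (h k)) p"
  by (simp add: lin_ext_def[of h] lin_ext_sum lin_ext_scale) (simp add: lin_ext_def)

lemma lin_ext_fun_scale: "lin_ext (\<lambda>k. scale c (g k)) p = scale c (lin_ext g p)"
  by (simp add: lin_ext_def free.scale_sum_right mult.commute)

lemma lin_ext_fun_diff: "lin_ext (\<lambda>k. g k - h k) p = lin_ext g p - lin_ext h p"
  by (simp add: lin_ext_def free.scale_right_diff_distrib sum_subtractf)

lemma lin_ext_mem_subspace:
  assumes "free.subspace W" "\<And>k. g k \<in> W"
  shows "lin_ext g p \<in> W"
  unfolding lin_ext_def
  by (intro free.subspace_sum free.subspace_scale assms)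

lemma subspace_tensor_rel: "free.subspace (tensor_rel M)"
  unfolding tensor_rel_def by (rule free.subspace_span)

lemma tensor_rel_generators:
  fixes M :: "('k::field, 'a, 'm) module_scheme"
  assumes "x \<in> carrier M" "z \<in> carrier M"
  shows tensor_rel_add_left: "y \<in> carrier M \<Longrightarrow> Poly_Mapping.single (x \<oplus>\<^bsub>M\<^esub> y, z) 1 -
      Poly_Mapping.single (x, z) 1 - Poly_Mapping.single (y, z) 1 \<in> tensor_rel M"
    and tensor_rel_add_right: "y \<in> carrier M \<Longrightarrow> Poly_Mapping.single (z, x \<oplus>\<^bsub>M\<^esub> y) 1 -
      Poly_Mapping.single (z, x) 1 - Poly_Mapping.single (z, y) 1 \<in> tensor_rel M"
    and tensor_rel_smult_left: "Poly_Mapping.single (c \<odot>\<^bsub>M\<^esub> x, z) 1 -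
      scale c (Poly_Mapping.single (x, z) 1) \<in> tensor_rel M"
    and tensor_rel_smult_right: "Poly_Mapping.single (z, c \<odot>\<^bsub>M\<^esub> x) 1 -
      scale c (Poly_Mapping.single (z, x) 1) \<in> tensor_rel M"
  unfolding tensor_rel_def Let_def by (rule free.span_base; use assms in blast)+

lemma tensor_rel_smult:
  fixes M :: "('k::field, 'a, 'm) module_scheme"
  assumes "x \<in> carrier M" "y \<in> carrier M" "d \<odot>\<^bsub>M\<^esub> y \<in> carrier M"
  shows "Poly_Mapping.single (c \<odot>\<^bsub>M\<^esub> x, d \<odot>\<^bsub>M\<^esub> y) 1 - Poly_Mapping.single (x, y) (c * d) \<in> tensor_rel M"
proof -
  have "Poly_Mapping.single (c \<odot>\<^bsub>M\<^esub> x, d \<odot>\<^bsub>M\<^esub> y) 1 -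
      scale c (Poly_Mapping.single (x, d \<odot>\<^bsub>M\<^esub> y) 1) \<in> tensor_rel M" (is "?p \<in> _")
    by (rule tensor_rel_smult_left) (rule assms)+
  moreover have "Poly_Mapping.single (x, d \<odot>\<^bsub>M\<^esub> y) 1 - scale d (Poly_Mapping.single (x, y) 1)
      \<in> tensor_rel M" (is "?q \<in> _")
    by (rule tensor_rel_smult_right) (rule assms)+
  ultimately have "?p + scale c ?q \<in> tensor_rel M"
    by (intro free.subspace_add free.subspace_scale subspace_tensor_rel)
  then show ?thesis by (simp add: free.scale_right_diff_distrib)
qed

text \<open>The preimage of the relations of \<open>N\<close> is a subspace, and it contains the
  generating relations of \<open>M\<close>.\<close>

lemma lin_ext_tensor_rel:
  fixes M :: "('k::field, 'a, 'm) module_scheme" and N :: "('k, 'b, 'n) module_scheme"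
  assumes carrier: "\<And>x. x \<in> carrier M \<Longrightarrow> \<phi> x \<in> carrier N"
    and add: "\<And>x y. x \<in> carrier M \<Longrightarrow> y \<in> carrier M \<Longrightarrow> \<phi> (x \<oplus>\<^bsub>M\<^esub> y) = \<phi> x \<oplus>\<^bsub>N\<^esub> \<phi> y"
    and smult: "\<And>c x. x \<in> carrier M \<Longrightarrow> \<phi> (c \<odot>\<^bsub>M\<^esub> x) = c \<odot>\<^bsub>N\<^esub> \<phi> x"
    and z: "z \<in> tensor_rel M"
  shows "lin_ext (\<lambda>(x, y). Poly_Mapping.single (\<phi> x, \<phi> y) 1) z \<in> tensor_rel N"
proof -
  let ?h = "lin_ext (\<lambda>(x, y). Poly_Mapping.single (\<phi> x, \<phi> y) (1::'k))"
  have "free.subspace {z. ?h z \<in> tensor_rel N}"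
    unfolding free.subspace_def
    by (auto simp: lin_ext_add lin_ext_scale
        intro: free.subspace_add free.subspace_scale free.subspace_0 subspace_tensor_rel)
  then have "tensor_rel M \<subseteq> {z. ?h z \<in> tensor_rel N}"
    unfolding tensor_rel_def[of M] Let_def
    by (rule free.span_minimal[rotated])
      (auto simp: lin_ext_diff add smult free.scale_one carrier tensor_rel_add_left tensor_rel_add_right
        tensor_rel_smult_left[simplified] tensor_rel_smult_right[simplified])
  then show ?thesis using z by blast
qed

lemma subspace_diff_iff:
  assumes "free.subspace W" "z - z' \<in> W"
  shows "w - z \<in> W \<longleftrightarrow> w - z' \<in> W"
proof -
  have "(w - z) + (z - z') = w - z'" "(w - z') - (z - z') = w - z" by simp_all
  then show ?thesis
    using free.subspace_add[OF assms(1) _ assms(2)] free.subspace_diff[OF assms(1) _ assms(2)]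
    by metis
qed

lemma tensor_class_eqI: "z - z' \<in> tensor_rel M \<Longrightarrow> tensor_class M z = tensor_class M z'"
  unfolding tensor_class_def using subspace_diff_iff[OF subspace_tensor_rel] by blast

text \<open>All representatives have the same image class, so the union defining
  \<open>tensor_map\<close> collapses.\<close>

lemma tensor_map_tensor_class:
  fixes M :: "('k::field, 'a, 'm) module_scheme" and N :: "('k, 'b, 'n) module_scheme"
  assumes "\<And>x. x \<in> carrier M \<Longrightarrow> \<phi> x \<in> carrier N"
    and "\<And>x y. x \<in> carrier M \<Longrightarrow> y \<in> carrier M \<Longrightarrow> \<phi> (x \<oplus>\<^bsub>M\<^esub> y) = \<phi> x \<oplus>\<^bsub>N\<^esub> \<phi> y"
    and "\<And>c x. x \<in> carrier M \<Longrightarrow> \<phi> (c \<odot>\<^bsub>M\<^esub> x) = c \<odot>\<^bsub>N\<^esub> \<phi> x"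
  shows "tensor_map N \<phi> (tensor_class M z) =
    tensor_class N (lin_ext (\<lambda>(x, y). Poly_Mapping.single (\<phi> x, \<phi> y) 1) z)"
proof -
  let ?h = "lin_ext (\<lambda>(x, y). Poly_Mapping.single (\<phi> x, \<phi> y) (1::'k))"
  have "tensor_class N (?h z') = tensor_class N (?h z)" if "z' \<in> tensor_class M z" for z'
  proof (rule tensor_class_eqI)
    have "?h (z' - z) \<in> tensor_rel N"
      by (rule lin_ext_tensor_rel[where M = M]) (use assms that in \<open>auto simp: tensor_class_def\<close>)
    then show "?h z' - ?h z \<in> tensor_rel N" by (simp add: lin_ext_diff)
  qed
  moreover have "z \<in> tensor_class M z"
    using free.subspace_0[OF subspace_tensor_rel] by (simp add: tensor_class_def)
  ultimately show ?thesis unfolding tensor_map_def by blast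
qed

lemma tensor_map_UN: "tensor_map N \<phi> (\<Union>x\<in>U. F x) = (\<Union>x\<in>U. tensor_map N \<phi> (F x))"
  by (auto simp: tensor_map_def)

section \<open>The quotient by the radical\<close>

lemma subspace_rad: "free.subspace (rad \<Omega>)"
  unfolding rad_def form_eq fa_form_def free.subspace_def
  by (auto simp: eval_lin_add eval_lin_scale)

lemma proj_def': "proj \<Omega> x = (\<lambda>h. h + x) ` rad \<Omega>"
  by (auto simp: proj_def a_r_coset_def' ring_of_type_algebra_def)

lemma mem_proj: "z \<in> proj \<Omega> x \<longleftrightarrow> z - x \<in> rad \<Omega>"
proof -
  have "z = (z - x) + x" by simp
  then have "z \<in> (\<lambda>h. h + x) ` rad \<Omega>" if "z - x \<in> rad \<Omega>"
    using that by (rule image_eqI)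
  then show ?thesis unfolding proj_def' by auto
qed

lemma proj_eqI: "x - y \<in> rad \<Omega> \<Longrightarrow> proj \<Omega> x = proj \<Omega> y"
  by (simp add: set_eq_iff mem_proj subspace_diff_iff[OF subspace_rad])

lemma mem_proj_self: "x \<in> proj \<Omega> x"
  using free.subspace_0[OF subspace_rad] by (simp add: mem_proj)

lemma f_star_simps:
  "carrier (f_star \<Omega>) = range (proj \<Omega>)"
  "U \<otimes>\<^bsub>f_star \<Omega>\<^esub> V = star \<Omega> U V"
  "\<one>\<^bsub>f_star \<Omega>\<^esub> = proj \<Omega> 1"
  "U \<oplus>\<^bsub>f_star \<Omega>\<^esub> V = (\<Union>x\<in>U. \<Union>y\<in>V. {x + y})"
  "c \<odot>\<^bsub>f_star \<Omega>\<^esub> U = (\<Union>x\<in>U. proj \<Omega> (scale c x))"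
  "comult (f_star \<Omega>) = rtilde \<Omega>"
  by (auto simp: f_star_def f_alg_def FactRing_def A_RCOSETS_def' proj_def set_add_def'
      ring_of_type_algebra_def)

text \<open>The two structures share carrier, addition and scalar action, and the bilinearity
  relations involve nothing else.\<close>

lemma tensor_class_f_alg: "tensor_class (f_alg \<Omega>) = tensor_class (f_star \<Omega>)"
  by (simp add: fun_eq_iff tensor_class_def tensor_rel_def f_star_def)

lemma smult_proj: "c \<odot>\<^bsub>f_star \<Omega>\<^esub> proj \<Omega> x = proj \<Omega> (scale c x)"
proof -
  have "proj \<Omega> (scale c z) = proj \<Omega> (scale c x)" if "z \<in> proj \<Omega> x" for z
    using that free.subspace_scale[OF subspace_rad, of "z - x" \<Omega> c]
    by (intro proj_eqI) (simp add: mem_proj free.scale_right_diff_distrib)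
  then show ?thesis using mem_proj_self unfolding f_star_simps by blast
qed

section \<open>Transfer between two data with the same Cartan datum\<close>

definition rescale :: "('a \<Rightarrow> 'k::field) \<Rightarrow> ('a \<Rightarrow>\<^sub>0 'k) \<Rightarrow> ('a \<Rightarrow>\<^sub>0 'k)" where
  "rescale g = lin_ext (\<lambda>k. Poly_Mapping.single k (g k))"

lemma lookup_rescale [simp]: "Poly_Mapping.lookup (rescale g p) k = g k * Poly_Mapping.lookup p k"
  by (simp add: rescale_def lin_ext_def lookup_sum lookup_single when_def in_keys_iff)

lemma eval_lin_rescale: "eval_lin g (rescale h p) = eval_lin (\<lambda>k. h k * g k) p"
  by (simp add: rescale_def eval_lin_lin_ext)

lemma lin_ext_rescale: "lin_ext g (rescale h p) = lin_ext (\<lambda>k. scale (h k) (g k)) p"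
  by (simp add: rescale_def lin_ext_lin_ext)

locale same_cartan =
  fixes \<Omega> \<Omega>' :: "'i::finite \<Rightarrow> 'i \<Rightarrow> int"
  assumes cartan: "\<Omega> i j + \<Omega> j i = \<Omega>' i j + \<Omega>' j i"
begin

text \<open>The word \<open>w\<close> is a power of \<open>t\<close> times a
  \<open>*\<close>-product for \<open>\<Omega>\<close>. Keeping that power and rewriting the
  \<open>*\<close>-product for \<open>\<Omega>'\<close> as a word gives the difference of
  exponents.\<close>

definition transfer :: "'i fa \<Rightarrow> 'i fa" where
  "transfer = rescale (\<lambda>w. tt powi (word_exp \<Omega> w - word_exp \<Omega>' w))"

lemma qpar_eq: "qpar \<Omega>' = qpar \<Omega>"
  by (simp add: fun_eq_iff qpar_def cartan)

lemma theta_norm_eq: "theta_norm \<Omega>' = theta_norm \<Omega>"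
  using cartan by (simp add: fun_eq_iff theta_norm_def dotf_def ang_wt)

lemma transfer_add: "transfer (x + y) = transfer x + transfer y"
  by (rule poly_mapping_eqI) (simp add: transfer_def lookup_add algebra_simps)

lemma transfer_scale: "transfer (scale c x) = scale c (transfer x)"
  by (rule poly_mapping_eqI) (simp add: transfer_def algebra_simps)

lemma transfer_single: "transfer (Poly_Mapping.single w c) =
    scale (tt powi (word_exp \<Omega> w - word_exp \<Omega>' w)) (Poly_Mapping.single w c)"
  by (simp add: transfer_def rescale_def mult.commute)

lemma transfer_1: "transfer 1 = 1"
  by (simp add: one_fa transfer_single)

lemma transfer_theta: "transfer (theta i) = theta i"
  by (simp add: theta_def transfer_single sqf_wt)

lemma bij_transfer: "bij transfer"
proof (rule o_bij)
  let ?g = "rescale (\<lambda>w. tt powi (word_exp \<Omega>' w - word_exp \<Omega> w))"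
  have inv: "tt powi (a - b) * (tt powi (b - a) * c) = c" for a b c
    by (simp flip: mult.assoc power_int_add)
  show "?g \<circ> transfer = id" "transfer \<circ> ?g = id"
    by (auto intro!: ext poly_mapping_eqI simp: transfer_def inv)
qed

lemma fa_form_transfer: "fa_form \<Omega>' (transfer x) (transfer y) = fa_form \<Omega> x y"
proof -
  have eq: "tt powi (word_exp \<Omega> u - word_exp \<Omega>' u) * (tt powi (word_exp \<Omega> w - word_exp \<Omega>' w) *
      (tt powi (word_exp \<Omega>' u + word_exp \<Omega>' w) * c)) = tt powi (word_exp \<Omega> u + word_exp \<Omega> w) * c"
    for u w c by (simp add: algebra_simps flip: mult.assoc power_int_add)
  show ?thesis
    by (simp add: fa_form_def transfer_def eval_lin_rescale qpar_eq theta_norm_eq eq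
        flip: eval_lin_fun_cmult)
qed

text \<open>For a surjective isometry, orthogonality to the whole target is orthogonality to all
  images.\<close>

lemma transfer_rad: "transfer ` rad \<Omega> = rad \<Omega>'"
proof -
  have surj: "surj transfer" using bij_transfer by (rule bij_is_surj)
  have "x \<in> rad \<Omega> \<longleftrightarrow> transfer x \<in> rad \<Omega>'" for x
  proof -
    have "(\<forall>y. fa_form \<Omega>' (transfer x) y = 0) \<longleftrightarrow> (\<forall>y\<in>range transfer. fa_form \<Omega>' (transfer x) y = 0)"
      unfolding surj by simp
    then show ?thesis by (simp add: rad_def form_eq fa_form_transfer)
  qed
  then have "rad \<Omega> = transfer -` rad \<Omega>'" by auto
  then show ?thesis by (simp add: surj)
qed

lemma transfer_proj: "transfer ` proj \<Omega> x = proj \<Omega>' (transfer x)"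
  unfolding proj_def' transfer_rad[symmetric] by (simp add: image_image transfer_add)

text \<open>The cross term of \<open>word_exp_append\<close> cancels against the twist of the
  product, separately for each datum.\<close>

lemma transfer_star_free: "transfer (star_free \<Omega> x y) = star_free \<Omega>' (transfer x) (transfer y)"
proof -
  have eq: "tt powi (- sqf \<Omega> (wt u) (wt w)) * tt powi (word_exp \<Omega> (u @ w) - word_exp \<Omega>' (u @ w)) =
      tt powi (word_exp \<Omega> u - word_exp \<Omega>' u) * (tt powi (word_exp \<Omega> w - word_exp \<Omega>' w) *
        tt powi (- sqf \<Omega>' (wt u) (wt w)))" for u w
    by (simp add: word_exp_append algebra_simps flip: power_int_add)
  show ?thesis
    unfolding star_free_def transfer_def lin_ext_rescale lin_ext_fun_scale[symmetric]
    by (simp add: rescale_def lin_ext_lin_ext eq)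
qed

lemma transfer_star: "transfer ` star \<Omega> U V = star \<Omega>' (transfer ` U) (transfer ` V)"
  by (simp add: star_def image_UN transfer_proj transfer_star_free)

text \<open>Both coproducts are given by the same \<open>shuffle\<close>, so only powers of
  \<open>t\<close> differ.\<close>

lemma r_transfer: "r \<Omega>' (transfer x) = rescale (\<lambda>(a, b). tt powi (word_exp \<Omega> a - word_exp \<Omega>' a +
    (word_exp \<Omega> b - word_exp \<Omega>' b) + sqf \<Omega> (wt a) (wt b) - sqf \<Omega>' (wt a) (wt b))) (r \<Omega> x)"
  (is "_ = rescale ?g _")
proof (rule poly_mapping_eqI)
  fix k :: "'i list \<times> 'i list"
  let ?\<delta> = "\<lambda>k'. if k' = k then 1 else (0::qvt)"
  \<comment> \<open>The exponents of \<open>w\<close> cancel, and \<open>?\<delta>\<close> fixes the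
    pair \<open>(a, b)\<close>, so the remaining scalar depends on \<open>k\<close> alone and can be
    taken out.\<close>
  have eq: "tt powi (word_exp \<Omega> w - word_exp \<Omega>' w) *
      (tt powi (word_exp \<Omega>' w - word_exp \<Omega>' a - word_exp \<Omega>' b - sqf \<Omega>' (wt a) (wt b)) * ?\<delta> (a, b)) =
    ?g k * (tt powi (word_exp \<Omega> w - word_exp \<Omega> a - word_exp \<Omega> b - sqf \<Omega> (wt a) (wt b)) * ?\<delta> (a, b))"
    for w a b
    by (cases "(a, b) = k") (auto simp: algebra_simps simp flip: power_int_add)
  have "tt powi (word_exp \<Omega> w - word_exp \<Omega>' w) * eval_lin ?\<delta> (r_word \<Omega>' w) =
      ?g k * eval_lin ?\<delta> (r_word \<Omega> w)" for w
    unfolding eval_lin_r_word qpar_eq shuffle_cmult[symmetric] eq ..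
  then show "Poly_Mapping.lookup (r \<Omega>' (transfer x)) k = Poly_Mapping.lookup (rescale ?g (r \<Omega> x)) k"
    unfolding lookup_rescale
    unfolding lookup_eq_eval_lin r_def transfer_def eval_lin_lin_ext eval_lin_rescale
    by (simp only: eval_lin_fun_cmult)
qed

section \<open>Transport of the operations on the quotient\<close>

lemma transfer_carrier: "U \<in> carrier (f_star \<Omega>) \<Longrightarrow> transfer ` U \<in> carrier (f_star \<Omega>')"
  by (auto simp: f_star_simps transfer_proj)

lemma transfer_set_add:
  "transfer ` (U \<oplus>\<^bsub>f_star \<Omega>\<^esub> V) = transfer ` U \<oplus>\<^bsub>f_star \<Omega>'\<^esub> transfer ` V"
  by (simp add: f_star_simps image_UN transfer_add)

lemma transfer_smult: "transfer ` (c \<odot>\<^bsub>f_star \<Omega>\<^esub> U) = c \<odot>\<^bsub>f_star \<Omega>'\<^esub> transfer ` U"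
  by (simp add: f_star_simps image_UN transfer_proj transfer_scale)

lemma transfer_rtilde:
  "rtilde \<Omega>' (transfer ` U) = tensor_map (f_star \<Omega>') ((`) transfer) (rtilde \<Omega> U)"
proof -
  define E where "E \<Psi> x = lin_ext (\<lambda>(u, w). Poly_Mapping.single
        (proj \<Psi> (Poly_Mapping.single u 1), proj \<Psi> (Poly_Mapping.single w 1))
        (tt powi (sqf \<Psi> (wt u) (wt w)))) (r \<Psi> x)" for \<Psi> :: "'i \<Rightarrow> 'i \<Rightarrow> int" and x
  let ?h = "lin_ext (\<lambda>(A, B). Poly_Mapping.single (transfer ` A, transfer ` B) (1::qvt))"
  let ?e = "\<lambda>w. tt powi (word_exp \<Omega> w - word_exp \<Omega>' w)"
  have "?h (E \<Omega> x) - E \<Omega>' (transfer x) \<in> tensor_rel (f_star \<Omega>')" for x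
  proof -
    let ?P = "\<lambda>u. proj \<Omega>' (Poly_Mapping.single u 1)"
    \<comment> \<open>In \<open>?f\<close> the powers of \<open>t\<close> from
      \<open>transfer\<close> sit inside the two tensor factors, in \<open>?f'\<close> they stand in
      front. The formal combinations differ, but only by bilinearity relations.\<close>
    let ?f = "\<lambda>(u, w). scale (tt powi (sqf \<Omega> (wt u) (wt w)))
        (Poly_Mapping.single (?e u \<odot>\<^bsub>f_star \<Omega>'\<^esub> ?P u, ?e w \<odot>\<^bsub>f_star \<Omega>'\<^esub> ?P w) 1)"
    let ?f' = "\<lambda>(u, w). scale (tt powi (sqf \<Omega> (wt u) (wt w)))
        (Poly_Mapping.single (?P u, ?P w) (?e u * ?e w))"
    have "?h (E \<Omega> x) = lin_ext ?f (r \<Omega> x)"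
      unfolding E_def lin_ext_lin_ext smult_proj
      by (simp add: case_prod_unfold transfer_proj transfer_single del: scale_single)
    moreover have "E \<Omega>' (transfer x) = lin_ext ?f' (r \<Omega> x)"
      unfolding E_def r_transfer lin_ext_rescale
      by (simp add: case_prod_unfold algebra_simps flip: power_int_add)
    moreover have "?f k - ?f' k \<in> tensor_rel (f_star \<Omega>')" for k
    proof -
      obtain u w where k: "k = (u, w)" by (cases k)
      have "Poly_Mapping.single (?e u \<odot>\<^bsub>f_star \<Omega>'\<^esub> ?P u, ?e w \<odot>\<^bsub>f_star \<Omega>'\<^esub> ?P w) 1 -
          Poly_Mapping.single (?P u, ?P w) (?e u * ?e w) \<in> tensor_rel (f_star \<Omega>')"
        by (rule tensor_rel_smult) (simp_all add: smult_proj f_star_simps(1))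
      then show ?thesis
        unfolding k case_prod_conv free.scale_right_diff_distrib[symmetric]
        by (rule free.subspace_scale[OF subspace_tensor_rel])
    qed
    ultimately show ?thesis
      by (simp only: lin_ext_fun_diff[symmetric] lin_ext_mem_subspace[OF subspace_tensor_rel])
  qed
  then have "tensor_class (f_star \<Omega>') (?h (E \<Omega> x)) = tensor_class (f_star \<Omega>') (E \<Omega>' (transfer x))" for x
    by (rule tensor_class_eqI)
  moreover have "tensor_map (f_star \<Omega>') ((`) transfer) (tensor_class (f_star \<Omega>) z) =
      tensor_class (f_star \<Omega>') (?h z)" for z
    by (rule tensor_map_tensor_class) (simp_all add: transfer_carrier transfer_set_add transfer_smult)
  ultimately have "tensor_map (f_star \<Omega>') ((`) transfer) (tensor_class (f_star \<Omega>) (E \<Omega> x)) =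
      tensor_class (f_star \<Omega>') (E \<Omega>' (transfer x))" for x
    by simp
  then show ?thesis
    unfolding rtilde_def tensor_class_f_alg E_def[symmetric] by (simp add: tensor_map_UN)
qed

lemma transfer_bialg_iso: "(`) transfer \<in> bialg_iso (f_star \<Omega>) (f_star \<Omega>')"
proof -
  have "(`) transfer \<in> ring_hom (f_star \<Omega>) (f_star \<Omega>')"
    by (rule ring_hom_memI)
      (simp_all add: transfer_carrier transfer_set_add f_star_simps(2,3) transfer_star transfer_proj
        transfer_1)
  moreover have "bij_betw ((`) transfer) (carrier (f_star \<Omega>)) (carrier (f_star \<Omega>'))"
    unfolding bij_betw_def
  proof
    show "inj_on ((`) transfer) (carrier (f_star \<Omega>))"
      using bij_transfer by (auto intro!: inj_onI simp: bij_def inj_image_eq_iff)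
    \<comment> \<open>Cosets go to cosets, so surjectivity on the quotients is inherited from
      \<open>transfer\<close>.\<close>
    have "(`) transfer ` range (proj \<Omega>) = proj \<Omega>' ` range transfer"
      by (simp add: image_image transfer_proj)
    then show "(`) transfer ` carrier (f_star \<Omega>) = carrier (f_star \<Omega>')"
      using bij_transfer by (simp add: f_star_simps bij_def)
  qed
  ultimately show ?thesis
    by (simp add: bialg_iso_def ring_iso_def transfer_smult transfer_rtilde f_star_simps(6))
qed

end

theorem corollary3:
  fixes \<Omega> \<Omega>' :: "'i::finite \<Rightarrow> 'i \<Rightarrow> int"
  assumes "admissible \<Omega>" and "admissible \<Omega>'"
    and "\<And>i j. \<Omega> i j + \<Omega> j i = \<Omega>' i j + \<Omega>' j i"
  shows "\<exists>\<phi> \<in> bialg_iso (f_star \<Omega>) (f_star \<Omega>').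
    \<forall>i. \<phi> (proj \<Omega> (theta i)) = proj \<Omega>' (theta i)"
proof -
  interpret same_cartan \<Omega> \<Omega>' by unfold_locales (rule assms(3))
  show ?thesis
    by (rule bexI[OF _ transfer_bialg_iso]) (simp add: transfer_proj transfer_theta)
qed

end
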